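(* Suppose that $c_0k^2\leq r=o(n^{1/2})$ for a suitable constant $c_0>0$. Then the algorithm $\mathtt{Decide}_k$, applied to the random regular graph $G_{n,r}$, has polynomial expected running time.
   Context: $G_{n,r}$ denotes an $r$-regular graph on $\{1,\dots,n\}$ chosen uniformly at random. The algorithm $\mathtt{Decide}_k$ on input $G$: (1) compute the vector chromatic number $\bar\vartheta_{1/2}(G)$ (in polynomial time); if $\bar\vartheta_{1/2}(G)>k$, output "$\chi(G)>k$" and stop; (2) otherwise compute $\chi(G)$ exactly in time $o(\exp(n))$ (Lawler's algorithm) and answer correctly whether $\chi(G)\leq k$. Here $\bar\vartheta_{1/2}(G)$ is the infimum of $k'>1$ such that there are unit vectors $v_1,\dots,v_n\in\mathbb R^n$ with $\langle v_i,v_j\rangle\leq-1/(k'-1)$ for all edges $\{i,j\}$. Polynomial expected running time means the expected running time over the random input is $O(n^l)$ for some constant $l$. *)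

theory Defs
  imports "HOL-Probability.Probability" "HOL-Library.Landau_Symbols"
begin

definition regular_graphs :: "nat \<Rightarrow> nat \<Rightarrow> nat set set set" where
  "regular_graphs n r =
     {E. E \<subseteq> {e. e \<subseteq> {1..n} \<and> card e = 2} \<and>
         (\<forall>v\<in>{1..n}. card {e\<in>E. v \<in> e} = r)}"

text \<open>The random regular graph G(n,r): uniform distribution on r-regular graphs
  on {1..n} (meaningful when this set is nonempty).\<close>
definition G_nr :: "nat \<Rightarrow> nat \<Rightarrow> nat set set pmf" where
  "G_nr n r = pmf_of_set (regular_graphs n r)"

definition vector_chromatic_number :: "nat \<Rightarrow> nat set set \<Rightarrow> real" where
  "vector_chromatic_number n E =
     Inf {k'. k' > 1 \<and>
        (\<exists>v :: nat \<Rightarrow> nat \<Rightarrow> real.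
            (\<forall>i\<in>{1..n}. (\<Sum>l\<in>{1..n}. (v i l)\<^sup>2) = 1) \<and>
            (\<forall>i\<in>{1..n}. \<forall>j\<in>{1..n}. {i, j} \<in> E \<longrightarrow>
                (\<Sum>l\<in>{1..n}. v i l * v j l) \<le> - 1 / (k' - 1)))}"

end

theory Submission
  imports Defs
begin

text \<open>Suppose the vector chromatic number of an \<open>r\<close>-regular graph is at most \<open>k\<close>, so that some
  unit vectors have inner product at most \<open>-1/k\<close> along every edge. For a standard Gaussian vector
  \<open>g\<close>, the numbers \<open>x i = sin \<langle>g, v i\<rangle>\<close> satisfy \<open>E (x i * x j) = sinh \<langle>v i, v j\<rangle> / e\<close>, which is at
  most \<open>-1/(e k)\<close> on edges. The sum of \<open>x i * x j\<close> over the edges is affine in each coordinate, so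
  some choice of signs does at least as well, that is, some cut has at least
  \<open>rn/4 + rn/(4 e k)\<close> edges.

  For a fixed vertex set \<open>S\<close>, such a large cut is exponentially unlikely. Replacing two cut edges
  \<open>ux\<close>, \<open>vy\<close> (with \<open>u, v\<close> in \<open>S\<close>) by \<open>uv\<close>, \<open>xy\<close> keeps the graph regular and lowers the cut size by
  two; if the cut has \<open>m > rn/4\<close> edges, about \<open>m\<^sup>2\<close> such switchings lead down, while at most
  \<open>(rn/2 - m)\<^sup>2\<close> lead back up. As \<open>m\<close> passes through the second half of a window of width
  \<open>D = 4 n \<surd>r\<close> above \<open>rn/4\<close>, the number of graphs therefore loses a factor \<open>exp (-2D/(rn))\<close> per
  step, in total about \<open>exp (-8n)\<close>. This beats both the \<open>2 ^ n\<close> choices of \<open>S\<close> and the running time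
  \<open>exp n\<close> of the exact algorithm. The condition \<open>k\<^sup>2 \<le> r / 3600\<close> makes \<open>rn/(4 e k)\<close> exceed \<open>D\<close>.\<close>

subsection \<open>Gaussian rounding\<close>

abbreviation gaussian :: "'l set \<Rightarrow> ('l \<Rightarrow> real) measure" where
  "gaussian I \<equiv> PiM I (\<lambda>_. std_normal_distribution)"

lemma prob_space_gaussian: "prob_space (gaussian I)"
  by (intro prob_space_PiM prob_space_normal_density) simp

text \<open>The characteristic function of a product of standard normal laws factors over the
  coordinates; this is its real part at \<open>w\<close>.\<close>

lemma gaussian_expectation_cos:
  fixes w :: "'l \<Rightarrow> real"
  assumes "finite I"
  shows "(\<integral>g. cos (\<Sum>l\<in>I. g l * w l) \<partial>gaussian I) = exp (- (\<Sum>l\<in>I. (w l)\<^sup>2) / 2)"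
proof -
  interpret N: prob_space std_normal_distribution
    by (rule prob_space_normal_density) simp
  interpret product_sigma_finite "\<lambda>_::'l. std_normal_distribution"
    by standard
  interpret G: prob_space "gaussian I" by (rule prob_space_gaussian)
  have int1: "integrable std_normal_distribution (\<lambda>x. iexp (x * w l))" for l
    by (rule N.integrable_iexp) auto
  have int: "integrable (gaussian I) (\<lambda>g. iexp (\<Sum>l\<in>I. g l * w l))"
    by (rule G.integrable_iexp) auto
  have "(\<integral>g. iexp (\<Sum>l\<in>I. g l * w l) \<partial>gaussian I)
      = (\<integral>g. (\<Prod>l\<in>I. iexp (g l * w l)) \<partial>gaussian I)"
    using assms by (simp add: exp_sum sum_distrib_left)
  also have "\<dots> = (\<Prod>l\<in>I. \<integral>x. iexp (x * w l) \<partial>std_normal_distribution)"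
    using assms int1 by (intro product_integral_prod)
  also have "\<dots> = (\<Prod>l\<in>I. char std_normal_distribution (w l))"
    by (simp add: char_def mult_ac)
  also have "\<dots> = complex_of_real (\<Prod>l\<in>I. exp (- (w l)\<^sup>2 / 2))"
    by (simp add: char_std_normal_distribution)
  also have "(\<Prod>l\<in>I. exp (- (w l)\<^sup>2 / 2)) = exp (- (\<Sum>l\<in>I. (w l)\<^sup>2) / 2)"
    using assms by (simp add: exp_sum[symmetric] sum_negf sum_divide_distrib)
  finally have *: "(\<integral>g. iexp (\<Sum>l\<in>I. g l * w l) \<partial>gaussian I)
      = complex_of_real (exp (- (\<Sum>l\<in>I. (w l)\<^sup>2) / 2))" .
  have "(\<integral>g. cos (\<Sum>l\<in>I. g l * w l) \<partial>gaussian I)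
      = (\<integral>g. Re (iexp (\<Sum>l\<in>I. g l * w l)) \<partial>gaussian I)"
    by (simp add: Re_exp)
  also have "\<dots> = Re (\<integral>g. iexp (\<Sum>l\<in>I. g l * w l) \<partial>gaussian I)"
    using int by (rule integral_Re)
  finally show ?thesis unfolding * by simp
qed

text \<open>The product-to-sum formula reduces this to cosine expectations at \<open>u - v\<close>
  and \<open>u + v\<close>, whose squared norms are \<open>2 - 2 * s\<close> and
  \<open>2 + 2 * s\<close> for unit vectors with inner product \<open>s\<close>.\<close>

lemma gaussian_expectation_sin_sin:
  fixes u v :: "'l \<Rightarrow> real"
  assumes "finite I" "(\<Sum>l\<in>I. (u l)\<^sup>2) = 1" "(\<Sum>l\<in>I. (v l)\<^sup>2) = 1"
  shows "(\<integral>g. sin (\<Sum>l\<in>I. g l * u l) * sin (\<Sum>l\<in>I. g l * v l) \<partial>gaussian I)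
       = exp (- 1) * sinh (\<Sum>l\<in>I. u l * v l)"
proof -
  interpret G: prob_space "gaussian I" by (rule prob_space_gaussian)
  let ?s = "\<Sum>l\<in>I. u l * v l"
  have int: "integrable (gaussian I) (\<lambda>g. cos (\<Sum>l\<in>I. g l * w l))" for w :: "'l \<Rightarrow> real"
    by (rule G.integrable_const_bound[of _ 1]) auto
  have minus: "(\<Sum>l\<in>I. (u l - v l)\<^sup>2) = 2 - 2 * ?s"
    and plus: "(\<Sum>l\<in>I. (u l + v l)\<^sup>2) = 2 + 2 * ?s"
    using assms
    by (simp_all add: power2_diff power2_sum sum.distrib sum_subtractf mult.assoc
        flip: sum_distrib_left)
  have "sin (\<Sum>l\<in>I. g l * u l) * sin (\<Sum>l\<in>I. g l * v l)
      = (cos (\<Sum>l\<in>I. g l * (u l - v l)) - cos (\<Sum>l\<in>I. g l * (u l + v l))) / 2" for g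
    by (simp add: sin_times_sin algebra_simps sum.distrib sum_subtractf)
  then have "(\<integral>g. sin (\<Sum>l\<in>I. g l * u l) * sin (\<Sum>l\<in>I. g l * v l) \<partial>gaussian I)
      = (\<integral>g. (cos (\<Sum>l\<in>I. g l * (u l - v l)) - cos (\<Sum>l\<in>I. g l * (u l + v l))) / 2 \<partial>gaussian I)"
    by presburger
  also have "\<dots> = ((\<integral>g. cos (\<Sum>l\<in>I. g l * (u l - v l)) \<partial>gaussian I)
        - (\<integral>g. cos (\<Sum>l\<in>I. g l * (u l + v l)) \<partial>gaussian I)) / 2"
    using int by simp
  also have "\<dots> = (exp (- (2 - 2 * ?s) / 2) - exp (- (2 + 2 * ?s) / 2)) / 2"
    using assms(1) by (simp only: gaussian_expectation_cos minus plus)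
  also have "- (2 - 2 * ?s) / 2 = - 1 + ?s" by simp
  also have "- (2 + 2 * ?s) / 2 = - 1 + - ?s" by simp
  also have "(exp (- 1 + ?s) - exp (- 1 + - ?s)) / 2 = exp (- 1) * sinh ?s"
    by (simp only: exp_add sinh_def) (simp add: field_simps)
  finally show ?thesis .
qed

lemma real_le_sinh: "x \<le> sinh x" if "0 \<le> x" for x :: real
proof -
  have "sinh 0 - 0 \<le> sinh x - x"
    using that
  proof (rule DERIV_nonneg_imp_nondecreasing)
    fix t :: real
    show "\<exists>y. ((\<lambda>x. sinh x - x) has_real_derivative y) (at t) \<and> 0 \<le> y"
      by (intro exI[of _ "cosh t - 1"]) (auto intro!: derivative_eq_intros cosh_real_ge_1)
  qed
  then show ?thesis by simp
qed

text \<open>Some \<open>g\<close> does at least as well as the expectation. As \<open>sinh\<close>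
  is odd and dominates the identity on nonnegative reals, the bound \<open>- \<delta>\<close>
  survives it, and only the factor \<open>exp (- 1)\<close> is lost.\<close>

lemma exists_bounded_rounding:
  fixes v :: "'i \<Rightarrow> 'l \<Rightarrow> real"
  assumes "finite I" "finite B" "0 \<le> \<delta>"
    and unit: "\<And>i j. (i, j) \<in> B \<Longrightarrow> (\<Sum>l\<in>I. (v i l)\<^sup>2) = 1 \<and> (\<Sum>l\<in>I. (v j l)\<^sup>2) = 1"
    and inner: "\<And>i j. (i, j) \<in> B \<Longrightarrow> (\<Sum>l\<in>I. v i l * v j l) \<le> - \<delta>"
  shows "\<exists>x. (\<forall>i. \<bar>x i\<bar> \<le> 1) \<and> (\<Sum>(i, j)\<in>B. x i * x j) \<le> - exp (- 1) * \<delta> * real (card B)"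
proof -
  interpret G: prob_space "gaussian I" by (rule prob_space_gaussian)
  define x :: "('l \<Rightarrow> real) \<Rightarrow> 'i \<Rightarrow> real" where "x g i = sin (\<Sum>l\<in>I. g l * v i l)" for g i
  have int1: "integrable (gaussian I) (\<lambda>g. x g i * x g j)" for i j
    unfolding x_def
    by (rule G.integrable_const_bound[of _ 1])
      (auto simp: abs_mult intro!: mult_le_one)
  then have int: "integrable (gaussian I) (\<lambda>g. \<Sum>(i, j)\<in>B. x g i * x g j)"
    by (auto simp: case_prod_unfold)
  have "sinh (\<Sum>l\<in>I. v i l * v j l) \<le> - \<delta>" if "(i, j) \<in> B" for i j
  proof -
    have "\<delta> \<le> sinh (- (\<Sum>l\<in>I. v i l * v j l))"
      using inner[OF that] \<open>0 \<le> \<delta>\<close> real_le_sinh[of "- (\<Sum>l\<in>I. v i l * v j l)"] by linarith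
    then show ?thesis by simp
  qed
  then have term_le: "(\<integral>g. x g i * x g j \<partial>gaussian I) \<le> exp (- 1) * (- \<delta>)" if "(i, j) \<in> B" for i j
    using that unit[OF that] \<open>finite I\<close> unfolding x_def
    by (simp only: gaussian_expectation_sin_sin) (intro mult_left_mono; simp)
  have "(\<integral>g. (\<Sum>(i, j)\<in>B. x g i * x g j) \<partial>gaussian I)
      = (\<Sum>(i, j)\<in>B. \<integral>g. x g i * x g j \<partial>gaussian I)"
    using int1 by (simp add: case_prod_unfold)
  also have "\<dots> \<le> (\<Sum>(i, j)\<in>B. exp (- 1) * (- \<delta>))"
    using term_le by (intro sum_mono) auto
  also have "\<dots> = - exp (- 1) * \<delta> * real (card B)"
    by simp
  finally have E: "(\<integral>g. (\<Sum>(i, j)\<in>B. x g i * x g j) \<partial>gaussian I) \<le> - exp (- 1) * \<delta> * real (card B)" .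
  obtain g where "(\<Sum>(i, j)\<in>B. x g i * x g j) \<le> - exp (- 1) * \<delta> * real (card B)"
    using G.expectation_greater[OF int, of "- exp (- 1) * \<delta> * real (card B)"] E
    by (force simp: not_less)
  moreover have "\<bar>x g i\<bar> \<le> 1" for i by (simp add: x_def)
  ultimately show ?thesis by blast
qed

section \<open>Rounding bounded values to signs\<close>

lemma sum_products_affine:
  fixes x :: "'i \<Rightarrow> real"
  assumes "\<And>i. (i, i) \<notin> B"
  shows "\<exists>a b. \<forall>t. (\<Sum>(i, j)\<in>B. (x(k := t)) i * (x(k := t)) j) = a + b * t"
proof -
  define a where "a i j = (if i = k \<or> j = k then 0 else x i * x j)" for i j
  define b where "b i j = (if i = k then x j else if j = k then x i else 0)" for i j
  \<comment> \<open>Without diagonal pairs \<open>t\<close> is never multiplied by itself, so no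
    quadratic term appears.\<close>
  have "(x(k := t)) i * (x(k := t)) j = a i j + b i j * t" if "(i, j) \<in> B" for i j t
    using assms that by (cases "i = j") (auto simp: a_def b_def)
  then have "(\<Sum>(i, j)\<in>B. (x(k := t)) i * (x(k := t)) j)
      = (\<Sum>(i, j)\<in>B. a i j + b i j * t)" for t
    by (intro sum.cong) auto
  then have "(\<Sum>(i, j)\<in>B. (x(k := t)) i * (x(k := t)) j)
      = (\<Sum>(i, j)\<in>B. a i j) + (\<Sum>(i, j)\<in>B. b i j) * t" for t
    by (simp add: case_prod_unfold sum.distrib sum_distrib_right)
  then show ?thesis by blast
qed

text \<open>An affine function on [-1, 1] is smallest at an endpoint, so the coordinates in
  \<open>K\<close> can be moved to signs one at a time. Keeping all values in [-1, 1] lets the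
  remaining coordinates be moved later.\<close>

lemma exists_sign_rounding:
  fixes x :: "'i \<Rightarrow> real"
  assumes "\<And>i. (i, i) \<notin> B" "finite K" "\<And>i. \<bar>x i\<bar> \<le> 1"
  shows "\<exists>s. (\<forall>i\<in>K. s i = 1 \<or> s i = - 1) \<and> (\<forall>i. \<bar>s i\<bar> \<le> 1) \<and>
    (\<Sum>(i, j)\<in>B. s i * s j) \<le> (\<Sum>(i, j)\<in>B. x i * x j)"
  using assms(2)
proof induction
  case empty
  then show ?case using assms(3) by auto
next
  case (insert k K)
  then obtain s where s: "\<forall>i\<in>K. s i = 1 \<or> s i = - 1" "\<forall>i. \<bar>s i\<bar> \<le> 1"
    "(\<Sum>(i, j)\<in>B. s i * s j) \<le> (\<Sum>(i, j)\<in>B. x i * x j)" by blast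
  obtain a b where ab: "(\<Sum>(i, j)\<in>B. (s(k := t)) i * (s(k := t)) j) = a + b * t" for t
    using sum_products_affine[OF assms(1)] by metis
  define t :: real where "t = (if b \<ge> 0 then - 1 else 1)"
  have "\<bar>s k\<bar> \<le> 1" using s(2) by blast
  then have "b * t \<le> b * s k"
    using mult_left_mono[of "- 1" "s k" b] mult_left_mono_neg[of "s k" 1 b] by (simp add: t_def)
  then have "(\<Sum>(i, j)\<in>B. (s(k := t)) i * (s(k := t)) j) \<le> (\<Sum>(i, j)\<in>B. s i * s j)"
    using ab[of t] ab[of "s k"] by (simp only: fun_upd_triv)
  with s have "(\<forall>i\<in>insert k K. (s(k := t)) i = 1 \<or> (s(k := t)) i = - 1) \<and> (\<forall>i. \<bar>(s(k := t)) i\<bar> \<le> 1) \<and>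
    (\<Sum>(i, j)\<in>B. (s(k := t)) i * (s(k := t)) j) \<le> (\<Sum>(i, j)\<in>B. x i * x j)"
    by (auto simp: t_def)
  then show ?case by blast
qed

subsection \<open>Switchings in regular graphs\<close>

text \<open>Ordered pairs: an edge between disjoint \<open>S\<close> and \<open>T\<close> is counted
  once, an edge inside \<open>S\<close> twice in \<open>arcs S S E\<close>.\<close>

definition arcs :: "'a set \<Rightarrow> 'a set \<Rightarrow> 'a set set \<Rightarrow> ('a \<times> 'a) set" where
  "arcs S T E = {(u, w). u \<in> S \<and> w \<in> T \<and> {u, w} \<in> E}"

definition switch :: "'a \<Rightarrow> 'a \<Rightarrow> 'a \<Rightarrow> 'a \<Rightarrow> 'a set set \<Rightarrow> 'a set set" where
  "switch u x v y E = E - {{u, x}, {v, y}} \<union> {{u, v}, {x, y}}"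

lemma finite_arcs [simp]: "finite S \<Longrightarrow> finite T \<Longrightarrow> finite (arcs S T E)"
  by (rule finite_subset[of _ "S \<times> T"]) (auto simp: arcs_def)

lemma card_arcs_commute: "card (arcs S T E) = card (arcs T S E)"
proof -
  have "arcs S T E = prod.swap ` arcs T S E"
    by (auto simp: arcs_def image_iff insert_commute)
  then show ?thesis by (simp add: card_image)
qed

lemma arcs_Un_right: "arcs S (T \<union> U) E = arcs S T E \<union> arcs S U E"
  by (auto simp: arcs_def)

lemma card_arcs_Un_right:
  assumes "finite S" "finite T" "finite U" "T \<inter> U = {}"
  shows "card (arcs S (T \<union> U) E) = card (arcs S T E) + card (arcs S U E)"
  unfolding arcs_Un_right
proof (rule card_Un_disjoint)
  show "arcs S T E \<inter> arcs S U E = {}" using assms(4) by (auto simp: arcs_def)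
qed (use assms in simp_all)

lemma finite_regular_graphs: "finite (regular_graphs n r)"
  by (rule finite_subset[of _ "Pow (Pow {1..n})"]) (auto simp: regular_graphs_def)

lemma regular_graphs_edgeD:
  assumes "E \<in> regular_graphs n r" "{u, w} \<in> E"
  shows "u \<in> {1..n}" "w \<in> {1..n}" "u \<noteq> w"
proof -
  have "{u, w} \<subseteq> {1..n} \<and> card {u, w} = 2"
    using assms unfolding regular_graphs_def by blast
  then show "u \<in> {1..n}" "w \<in> {1..n}" "u \<noteq> w" by auto
qed

text \<open>Degrees are defined through incident edges; the map from \<open>w\<close> to
  \<open>{v, w}\<close> matches these with neighbours.\<close>

lemma card_neighbours:
  assumes E: "E \<in> regular_graphs n r" and "v \<in> {1..n}"
  shows "card {w. {v, w} \<in> E} = r"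
proof -
  have "{e \<in> E. v \<in> e} = (\<lambda>w. {v, w}) ` {w. {v, w} \<in> E}"
  proof (intro equalityI subsetI)
    fix e assume e: "e \<in> {e \<in> E. v \<in> e}"
    then have "card e = 2" using E by (auto simp: regular_graphs_def)
    then obtain a b where "e = {a, b}" by (auto simp: card_2_iff)
    with e have "e = {v, a} \<or> e = {v, b}" by auto
    with e show "e \<in> (\<lambda>w. {v, w}) ` {w. {v, w} \<in> E}" by auto
  qed auto
  moreover have "inj_on (\<lambda>w. {v, w}) {w. {v, w} \<in> E}"
    by (rule inj_onI) (auto simp: doubleton_eq_iff)
  ultimately have "card {e \<in> E. v \<in> e} = card {w. {v, w} \<in> E}"
    by (simp add: card_image)
  then show ?thesis using assms by (auto simp: regular_graphs_def)
qed

lemma finite_neighbours: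
  assumes "E \<in> regular_graphs n r"
  shows "finite {w. {v, w} \<in> E}"
  by (rule finite_subset[of _ "{1..n}"]) (use regular_graphs_edgeD[OF assms] in auto)

lemma card_arcs_from:
  assumes E: "E \<in> regular_graphs n r" and "S \<subseteq> {1..n}"
  shows "card (arcs S {1..n} E) = card S * r"
proof -
  have "arcs S {1..n} E = Sigma S (\<lambda>v. {w. {v, w} \<in> E})"
    using regular_graphs_edgeD[OF E] by (auto simp: arcs_def)
  moreover have "finite S" using assms(2) finite_subset by blast
  ultimately show ?thesis
    using assms card_neighbours[OF E] finite_neighbours[OF E]
    by (simp add: card_SigmaI subset_iff)
qed

text \<open>All vertices together send out \<open>r * n\<close> arcs, and each cut edge accounts for
  two of them, one per direction.\<close>

lemma card_arcs_cut:
  assumes E: "E \<in> regular_graphs n r" and S: "S \<subseteq> {1..n}"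
  shows "card (arcs S S E) + card (arcs ({1..n} - S) ({1..n} - S) E)
    + 2 * card (arcs S ({1..n} - S) E) = r * n"
proof -
  let ?V = "{1..n}" and ?T = "{1..n} - S"
  have fin: "finite S" using S finite_subset by blast
  have V: "?V = S \<union> ?T" "?V = ?T \<union> S" using S by auto
  have "card (arcs S ?V E) = card (arcs S S E) + card (arcs S ?T E)"
    using card_arcs_Un_right[of S S ?T E] fin V by simp
  moreover have "card (arcs ?T ?V E) = card (arcs ?T S E) + card (arcs ?T ?T E)"
    using card_arcs_Un_right[of ?T S ?T E] fin V by simp
  moreover have "card (arcs S ?V E) + card (arcs ?T ?V E) = r * n"
  proof -
    have "card S + card ?T = n"
      using S fin card_mono[of ?V S] by (simp add: card_Diff_subset)
    then have "(card S + card ?T) * r = n * r" by simp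
    then show ?thesis
      using card_arcs_from[OF E S] card_arcs_from[OF E, of ?T]
      by (simp add: algebra_simps)
  qed
  ultimately show ?thesis using card_arcs_commute[of S ?T E] by simp
qed

lemma card_exchange:
  assumes "finite A" "a \<in> A" "b \<notin> A"
  shows "card (insert b (A - {a})) = card A"
  using assms card.remove[of A a] by simp

text \<open>Each of the four vertices loses one edge and gains one. The non-edge conditions make the
  gained edges new, and distinctness makes them genuine two-element sets.\<close>

lemma switch_regular_graphs:
  assumes E: "E \<in> regular_graphs n r"
    and mem: "{u, x} \<in> E" "{v, y} \<in> E" "{u, v} \<notin> E" "{x, y} \<notin> E"
    and dist: "distinct [u, v, x, y]"
  shows "switch u x v y E \<in> regular_graphs n r"
proof -
  let ?E = "switch u x v y E"
  have V: "u \<in> {1..n}" "v \<in> {1..n}" "x \<in> {1..n}" "y \<in> {1..n}"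
    using regular_graphs_edgeD[OF E mem(1)] regular_graphs_edgeD[OF E mem(2)] by auto
  have "finite E" using E
    by (intro finite_subset[of E "Pow {1..n}"]) (auto simp: regular_graphs_def)
  then have fin: "finite {e \<in> E. w \<in> e}" for w by simp
  \<comment> \<open>At \<open>w\<close> the edge \<open>a\<close> is traded for \<open>b\<close>,
    while \<open>c\<close> and \<open>d\<close> avoid \<open>w\<close>. The reorderings in
    \<open>E_eq\<close> bring the other vertices into this shape.\<close>
  have exch: "card {e \<in> E - {a, c} \<union> {b, d}. w \<in> e} = card {e \<in> E. w \<in> e}"
    if "a \<in> E" "b \<notin> E" "w \<in> a" "w \<in> b" "w \<notin> c" "w \<notin> d" for a b c d w
  proof -
    have "{e \<in> E - {a, c} \<union> {b, d}. w \<in> e} = insert b ({e \<in> E. w \<in> e} - {a})"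
      using that by auto
    then show ?thesis using that fin card_exchange[of "{e \<in> E. w \<in> e}" a b] by simp
  qed
  have E_eq: "?E = E - {{v, y}, {u, x}} \<union> {{u, v}, {x, y}}"
    "?E = E - {{u, x}, {v, y}} \<union> {{x, y}, {u, v}}"
    "?E = E - {{v, y}, {u, x}} \<union> {{x, y}, {u, v}}"
    by (auto simp: switch_def)
  have "card {e \<in> ?E. w \<in> e} = card {e \<in> E. w \<in> e}" for w
  proof -
    consider "w = u" | "w = v" | "w = x" | "w = y" | "w \<notin> {u, v, x, y}" by blast
    then show ?thesis
    proof cases
      case 1
      then show ?thesis
        using exch[of "{u, x}" "{u, v}" w "{v, y}" "{x, y}"] dist mem by (simp add: switch_def)
    next
      case 2
      then show ?thesis
        using exch[of "{v, y}" "{u, v}" w "{u, x}" "{x, y}"] dist mem by (simp add: E_eq(1))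
    next
      case 3
      then show ?thesis
        using exch[of "{u, x}" "{x, y}" w "{v, y}" "{u, v}"] dist mem by (simp add: E_eq(2))
    next
      case 4
      then show ?thesis
        using exch[of "{v, y}" "{x, y}" w "{u, x}" "{u, v}"] dist mem by (simp add: E_eq(3))
    next
      case 5
      then have "{e \<in> ?E. w \<in> e} = {e \<in> E. w \<in> e}"
        by (auto simp: switch_def)
      then show ?thesis by simp
    qed
  qed
  moreover have "?E \<subseteq> {e. e \<subseteq> {1..n} \<and> card e = 2}"
    using E V dist by (auto simp: switch_def regular_graphs_def)
  ultimately show ?thesis using E by (simp add: regular_graphs_def)
qed

text \<open>Exchanging the two middle arguments gives the inverse switching; this makes the later
  counting map injective.\<close>

lemma switch_switch:
  assumes "{u, x} \<in> E" "{v, y} \<in> E" "{u, v} \<notin> E" "{x, y} \<notin> E"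
  shows "switch u v x y (switch u x v y E) = E"
  using assms by (auto simp: switch_def)

lemma arcs_cut_switch:
  assumes "u \<in> S" "v \<in> S" "x \<in> T" "y \<in> T" "S \<inter> T = {}"
  shows "arcs S T (switch u x v y E) = arcs S T E - {(u, x), (v, y)}"
  using assms by (auto simp: arcs_def switch_def doubleton_eq_iff)

text \<open>The new edges \<open>uv\<close> and \<open>xy\<close> lie inside \<open>S\<close> and
  inside \<open>T\<close>, so the cut only loses arcs; \<open>u \<noteq> v\<close> guarantees that
  two different ones disappear.\<close>

lemma card_arcs_cut_switch:
  assumes "finite S" "finite T" "S \<inter> T = {}"
    and "(u, x) \<in> arcs S T E" "(v, y) \<in> arcs S T E" "u \<noteq> v"
  shows "card (arcs S T (switch u x v y E)) + 2 = card (arcs S T E)"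
proof -
  have sub: "{(u, x), (v, y)} \<subseteq> arcs S T E" using assms by simp
  have "arcs S T (switch u x v y E) = arcs S T E - {(u, x), (v, y)}"
    using assms by (intro arcs_cut_switch) (auto simp: arcs_def)
  moreover have "card {(u, x), (v, y)} = 2" using assms by simp
  moreover have "card {(u, x), (v, y)} \<le> card (arcs S T E)"
    using assms sub by (intro card_mono) auto
  ultimately show ?thesis using sub by (simp add: card_Diff_subset)
qed

section \<open>Counting switchings across a cut\<close>

definition switchable :: "'a set \<Rightarrow> 'a set \<Rightarrow> 'a set set \<Rightarrow> (('a \<times> 'a) \<times> 'a \<times> 'a) set" where
  "switchable S T E = {((u, x), (v, y)). (u, x) \<in> arcs S T E \<and> (v, y) \<in> arcs S T E \<and>
     u \<noteq> v \<and> x \<noteq> y \<and> {u, v} \<notin> E \<and> {x, y} \<notin> E}"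

text \<open>A closed neighbourhood has at most \<open>r + 1\<close> vertices, each the start of
  \<open>r\<close> arcs.\<close>

lemma card_arcs_near_le:
  assumes E: "E \<in> regular_graphs n r"
  shows "card (arcs (insert u {w. {u, w} \<in> E} \<inter> {1..n}) {1..n} E) \<le> (r + 1) * r"
proof -
  let ?N = "insert u {w. {u, w} \<in> E} \<inter> {1..n}"
  have "card ?N \<le> r + 1"
  proof (cases "u \<in> {1..n}")
    case True
    have "card ?N \<le> card (insert u {w. {u, w} \<in> E})"
      using finite_neighbours[OF E] by (intro card_mono) auto
    also have "\<dots> \<le> card {w. {u, w} \<in> E} + 1"
      by (simp add: card_insert_if finite_neighbours[OF E])
    finally show ?thesis using card_neighbours[OF E True] by simp
  next
    case False
    then have "?N = {}" using regular_graphs_edgeD[OF E, of u] by auto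
    then show ?thesis by (simp only: card.empty)
  qed
  then show ?thesis using card_arcs_from[OF E, of ?N] by (simp del: Int_insert_left mult_Suc)
qed

text \<open>An ordered pair of cut arcs fails to be switchable only if the two heads, or the two tails,
  are equal or adjacent.\<close>

lemma card_switchable_ge:
  assumes E: "E \<in> regular_graphs n r" and ST: "S \<subseteq> {1..n}" "T \<subseteq> {1..n}"
  shows "card (arcs S T E) * card (arcs S T E)
    \<le> card (switchable S T E) + card (arcs S T E) * (2 * ((r + 1) * r))"
proof -
  let ?A = "arcs S T E" and ?V = "{1..n}"
  define N where "N u = insert u {w. {u, w} \<in> E} \<inter> ?V" for u
  \<comment> \<open>\<open>D (u, x)\<close> contains the arcs \<open>(v, y)\<close> that spoil a
    switching with \<open>(u, x)\<close>: those with \<open>v\<close> in the closed neighbourhood of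
    \<open>u\<close>, or \<open>y\<close> in that of \<open>x\<close>. The latter are counted from
    \<open>y\<close>, hence the reversal.\<close>
  define D where "D = (\<lambda>(u, x). arcs (N u) ?V E \<union> prod.swap ` arcs (N x) ?V E)"
  have fin: "finite S" "finite T" using ST finite_subset by blast+
  have finA: "finite ?A" using fin by simp
  have finD: "finite (D p)" for p
    by (auto simp: D_def N_def case_prod_unfold)
  have "card (D p) \<le> 2 * ((r + 1) * r)" for p
  proof -
    have "card (D p) \<le> card (arcs (N (fst p)) ?V E) + card (prod.swap ` arcs (N (snd p)) ?V E)"
      by (auto simp: D_def case_prod_unfold intro: card_Un_le)
    also have "\<dots> \<le> (r + 1) * r + (r + 1) * r"
      using card_arcs_near_le[OF E] unfolding N_def
      by (intro add_mono) (simp_all add: card_image)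
    finally show ?thesis by simp
  qed
  then have "(\<Sum>p\<in>?A. card (D p)) \<le> card ?A * (2 * ((r + 1) * r))"
    using sum_bounded_above[of ?A "\<lambda>p. card (D p)" "2 * ((r + 1) * r)"] by simp
  then have "card (Sigma ?A D) \<le> card ?A * (2 * ((r + 1) * r))"
    using finA finD card_SigmaI[of ?A D] by simp
  moreover have "?A \<times> ?A \<subseteq> switchable S T E \<union> Sigma ?A D"
  proof
    fix z assume "z \<in> ?A \<times> ?A"
    then obtain u x v y where z: "z = ((u, x), (v, y))" and A: "(u, x) \<in> ?A" "(v, y) \<in> ?A"
      by auto
    have V: "v \<in> ?V" "y \<in> ?V" "{v, y} \<in> E" "{y, v} \<in> E"
      using A ST by (auto simp: arcs_def insert_commute)
    show "z \<in> switchable S T E \<union> Sigma ?A D"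
    proof (cases "v \<in> N u \<or> y \<in> N x")
      case True
      then have "(v, y) \<in> D (u, x)"
      proof
        assume "v \<in> N u"
        then show ?thesis using V by (auto simp: D_def arcs_def)
      next
        assume "y \<in> N x"
        then have "(y, v) \<in> arcs (N x) ?V E" using V by (auto simp: arcs_def)
        then show ?thesis by (force simp: D_def)
      qed
      with A z show ?thesis by auto
    next
      case False
      with A z V show ?thesis by (auto simp: switchable_def N_def)
    qed
  qed
  moreover have "finite (switchable S T E)"
    by (rule finite_subset[of _ "?A \<times> ?A"]) (use finA in \<open>auto simp: switchable_def\<close>)
  ultimately have "card (?A \<times> ?A) \<le> card (switchable S T E) + card ?A * (2 * ((r + 1) * r))"
    using finA finD card_mono[of "switchable S T E \<union> Sigma ?A D" "?A \<times> ?A"]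
      card_Un_le[of "switchable S T E" "Sigma ?A D"]
    by (meson add_left_mono finite_SigmaI finite_UnI le_trans)
  then show ?thesis by (simp add: card_cartesian_product)
qed

text \<open>Tails instead of exact cut sizes: switchings move the size by two, and monotonicity in
  \<open>M\<close> absorbs parity and rounding.\<close>

definition large_cut_graphs :: "nat \<Rightarrow> nat \<Rightarrow> nat set \<Rightarrow> nat \<Rightarrow> nat set set set" where
  "large_cut_graphs n r S M = {E \<in> regular_graphs n r. M \<le> card (arcs S ({1..n} - S) E)}"

lemma finite_large_cut_graphs: "finite (large_cut_graphs n r S M)"
  using finite_regular_graphs by (simp add: large_cut_graphs_def)

text \<open>Double counting: a graph with a switching is sent to the switched graph with its two new
  edges, taken as arcs inside \<open>S\<close> and inside the complement. These edges tell how to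
  switch back, so the map is injective.\<close>

lemma large_cut_switching:
  assumes S: "S \<subseteq> {1..n}"
  shows "(\<Sum>E\<in>large_cut_graphs n r S (M + 2). card (switchable S ({1..n} - S) E))
    \<le> (\<Sum>E\<in>large_cut_graphs n r S M. card (arcs S S E) * card (arcs ({1..n} - S) ({1..n} - S) E))"
proof -
  let ?T = "{1..n} - S"
  let ?L = "large_cut_graphs n r S"
  let ?f = "\<lambda>(E, (u, x), (v, y)). (switch u x v y E, (u, v), (x, y))"
  let ?X = "Sigma (?L (M + 2)) (\<lambda>E. switchable S ?T E)"
  let ?Y = "Sigma (?L M) (\<lambda>E. arcs S S E \<times> arcs ?T ?T E)"
  have fin: "finite S" "finite ?T" using S finite_subset by blast+
  have finsw: "finite (switchable S ?T E)" for E
    by (rule finite_subset[of _ "arcs S ?T E \<times> arcs S ?T E"])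
      (use fin in \<open>auto simp: switchable_def\<close>)
  have inj: "inj_on ?f ?X"
  proof (rule inj_on_inverseI)
    fix z assume "z \<in> ?X"
    then obtain E u x v y where z: "z = (E, (u, x), (v, y))" "((u, x), (v, y)) \<in> switchable S ?T E"
      by auto
    then show "(\<lambda>(E, (u, v), (x, y)). (switch u v x y E, (u, x), (v, y))) (?f z) = z"
      by (auto simp: switchable_def arcs_def switch_switch)
  qed
  have "?f ` ?X \<subseteq> ?Y"
  proof
    fix z' assume "z' \<in> ?f ` ?X"
    then obtain E u x v y where z': "z' = (switch u x v y E, (u, v), (x, y))"
      and E: "E \<in> ?L (M + 2)" and sw: "((u, x), (v, y)) \<in> switchable S ?T E"
      by auto
    have "switch u x v y E \<in> regular_graphs n r"
      using E sw by (intro switch_regular_graphs)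
        (auto simp: large_cut_graphs_def switchable_def arcs_def)
    moreover have "card (arcs S ?T (switch u x v y E)) + 2 = card (arcs S ?T E)"
      using fin sw by (intro card_arcs_cut_switch) (auto simp: switchable_def)
    ultimately have "switch u x v y E \<in> ?L M"
      using E by (auto simp: large_cut_graphs_def)
    moreover have "(u, v) \<in> arcs S S (switch u x v y E)" "(x, y) \<in> arcs ?T ?T (switch u x v y E)"
      using sw by (auto simp: switchable_def arcs_def switch_def)
    ultimately show "z' \<in> ?Y" using z' by simp
  qed
  then have "card ?X \<le> card ?Y"
    using inj fin finite_large_cut_graphs by (intro card_inj_on_le[of ?f]) auto
  then show ?thesis
    using fin finsw finite_large_cut_graphs by (simp add: card_SigmaI card_cartesian_product)
qed

text \<open>A cut of \<open>m\<close> edges has at least \<open>m * (m - 4 * r^2)\<close> switchings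
  down. The reverse moves are bounded by a product of two numbers with sum
  \<open>r * n - 2 * m\<close>, hence by \<open>(r * n / 2 - m)^2\<close>. For
  \<open>m \<ge> M\<close> the first bound is smallest and the second largest at
  \<open>m = M\<close>.\<close>

lemma large_cut_graphs_step:
  assumes S: "S \<subseteq> {1..n}" and M: "4 * r\<^sup>2 \<le> M"
  shows "real (card (large_cut_graphs n r S (M + 2))) * (real M * (real M - 4 * real r ^ 2))
    \<le> real (card (large_cut_graphs n r S M)) * (real r * real n / 2 - real M)\<^sup>2"
proof -
  let ?T = "{1..n} - S"
  let ?L = "large_cut_graphs n r S"
  have "real M * (real M - 4 * real r ^ 2) \<le> real (card (switchable S ?T E))"
    if "E \<in> ?L (M + 2)" for E
  proof -
    define m where "m = card (arcs S ?T E)"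
    have E: "E \<in> regular_graphs n r" and m: "M \<le> m"
      using that by (auto simp: large_cut_graphs_def m_def)
    have "m * m \<le> card (switchable S ?T E) + m * (2 * ((r + 1) * r))"
      using card_switchable_ge[OF E S, of ?T] by (simp add: m_def)
    \<comment> \<open>Natural numbers satisfy \<open>r \<le> r^2\<close>, also for
      \<open>r = 0\<close>.\<close>
    moreover have "m * (2 * ((r + 1) * r)) \<le> m * (4 * r\<^sup>2)"
      by (intro mult_left_mono) (simp_all add: power2_eq_square)
    ultimately have "m * m \<le> card (switchable S ?T E) + m * (4 * r\<^sup>2)" by linarith
    then have "real (m * m) \<le> real (card (switchable S ?T E) + m * (4 * r\<^sup>2))"
      by (rule of_nat_mono)
    then have "real m * (real m - 4 * real r ^ 2) \<le> real (card (switchable S ?T E))"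
      by (simp add: algebra_simps)
    moreover have "real M * (real M - 4 * real r ^ 2) \<le> real m * (real m - 4 * real r ^ 2)"
    proof (intro mult_mono)
      have "real (4 * r\<^sup>2) \<le> real M" using M by (rule of_nat_mono)
      then show "0 \<le> real M - 4 * real r ^ 2" by simp
    qed (use m in auto)
    ultimately show ?thesis by linarith
  qed
  then have "real (card (?L (M + 2))) * (real M * (real M - 4 * real r ^ 2))
      \<le> (\<Sum>E\<in>?L (M + 2). real (card (switchable S ?T E)))"
    using sum_mono[of "?L (M + 2)" "\<lambda>_. real M * (real M - 4 * real r ^ 2)"] by simp
  also have "\<dots> = real (\<Sum>E\<in>?L (M + 2). card (switchable S ?T E))" by simp
  also have "\<dots> \<le> real (\<Sum>E\<in>?L M. card (arcs S S E) * card (arcs ?T ?T E))"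
    by (rule of_nat_mono[OF large_cut_switching[OF S]])
  also have "\<dots> = (\<Sum>E\<in>?L M. real (card (arcs S S E)) * real (card (arcs ?T ?T E)))" by simp
  also have "\<dots> \<le> (\<Sum>E\<in>?L M. (real r * real n / 2 - real M)\<^sup>2)"
  proof (rule sum_mono)
    fix E assume "E \<in> ?L M"
    then have E: "E \<in> regular_graphs n r" and m: "M \<le> card (arcs S ?T E)"
      by (auto simp: large_cut_graphs_def)
    define a b m where "a = real (card (arcs S S E))" and "b = real (card (arcs ?T ?T E))"
      and "m = real (card (arcs S ?T E))"
    have "real (card (arcs S S E) + card (arcs ?T ?T E) + 2 * card (arcs S ?T E)) = real (r * n)"
      by (simp only: card_arcs_cut[OF E S])
    then have sum: "a + b = 2 * (real r * real n / 2 - m)"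
      by (simp add: a_def b_def m_def)
    have "4 * (a * b) \<le> (a + b)\<^sup>2"
      using zero_le_power2[of "a - b"] by (simp add: power2_diff power2_sum)
    also have "\<dots> = 4 * (real r * real n / 2 - m)\<^sup>2" by (simp only: sum power_mult_distrib) simp
    finally have "a * b \<le> (real r * real n / 2 - m)\<^sup>2" by simp
    also have "\<dots> \<le> (real r * real n / 2 - real M)\<^sup>2"
    proof (rule power_mono)
      show "0 \<le> real r * real n / 2 - m" using sum by (simp add: a_def b_def)
      show "real r * real n / 2 - m \<le> real r * real n / 2 - real M" using m by (simp add: m_def)
    qed
    finally show "real (card (arcs S S E)) * real (card (arcs ?T ?T E)) \<le> (real r * real n / 2 - real M)\<^sup>2"
      by (simp add: a_def b_def)
  qed
  finally show ?thesis by simp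
qed

subsection \<open>Large cuts are rare\<close>

text \<open>With \<open>N = r * n\<close>, going from \<open>N / 4 + D / 2\<close> to
  \<open>N / 4 + D\<close> takes about \<open>D / 4\<close> steps of width two, each gaining a
  factor \<open>exp (- 2 * D / N)\<close>; together this is \<open>exp (- D^2 / (2 * N))\<close>.
  The summand 1 in the exponent pays for rounding the number of steps.\<close>

lemma large_cut_tail:
  assumes S: "S \<subseteq> {1..n}" and "0 < r" "0 < n"
    and D: "8 * real r ^ 2 \<le> D" "2 * D \<le> real r * real n"
    and M: "real r * real n / 4 + D + 1 \<le> real M"
  shows "real (card (large_cut_graphs n r S M))
    \<le> exp (1 - D\<^sup>2 / (2 * (real r * real n))) * real (card (regular_graphs n r))"
proof -
  let ?L = "\<lambda>m. real (card (large_cut_graphs n r S m))"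
  define N where "N = real r * real n"
  have N: "0 < N" using assms by (simp add: N_def)
  have r2: "0 < real r ^ 2" using \<open>0 < r\<close> by simp
  have D0: "0 < D" using D(1) r2 by linarith
  define M0 where "M0 = nat \<lceil>N / 4 + D / 2\<rceil>"
  have M0: "N / 4 + D / 2 \<le> real M0" "real M0 \<le> N / 4 + D / 2 + 1"
    using N D0 by (simp_all add: M0_def)
  have step: "?L (m + 2) \<le> exp (- 2 * D / N) * ?L m" if m: "M0 \<le> m" for m
  proof (cases "real m \<le> N / 2")
    case True
    \<comment> \<open>For \<open>m = y + j\<close> the switching ratio is at most
      \<open>(y - j)^2 / ((y + j) * y)\<close>, because \<open>4 * r^2 \<le> D / 2 \<le> j\<close>.
      This is at most \<open>1 - j / y \<le> exp (- j / y)\<close>, and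
      \<open>j / y \<ge> 2 * D / N\<close>.\<close>
    define y j where "y = N / 4" and "j = real m - N / 4"
    have y: "0 < y" and j: "D / 2 \<le> j" "j \<le> y"
      using N M0 m True by (simp_all add: y_def j_def)
    have m_eq: "real m = y + j" "N / 2 - real m = y - j"
      by (simp_all add: y_def j_def)
    have "real (4 * r\<^sup>2) \<le> real m" using D(1) j y by (simp add: m_eq)
    then have "4 * r\<^sup>2 \<le> m" by (simp only: of_nat_le_iff)
    from large_cut_graphs_step[OF S this]
    have 1: "?L (m + 2) * ((y + j) * (y + j - 4 * real r ^ 2)) \<le> ?L m * (y - j)\<^sup>2"
      unfolding N_def[symmetric] m_eq(2) unfolding m_eq(1) .
    have "(y + j) * y \<le> (y + j) * (y + j - 4 * real r ^ 2)"
      using y j D0 D(1) by - (rule mult_left_mono; auto)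
    then have "?L (m + 2) * ((y + j) * y) \<le> ?L (m + 2) * ((y + j) * (y + j - 4 * real r ^ 2))"
      by - (rule mult_left_mono; auto)
    also note 1
    also have "(y - j)\<^sup>2 \<le> (y + j) * (y - j)"
      unfolding power2_eq_square using y j D0 by - (rule mult_right_mono; auto)
    then have "?L m * (y - j)\<^sup>2 \<le> ?L m * ((y + j) * (y - j))"
      by - (rule mult_left_mono; auto)
    finally have "(y + j) * (?L (m + 2) * y) \<le> (y + j) * (?L m * (y - j))"
      by (simp add: mult_ac)
    then have "?L (m + 2) * y \<le> ?L m * (y - j)"
      using y j D0 by (subst (asm) mult_le_cancel_left_pos) auto
    then have "?L (m + 2) \<le> ?L m * (1 - j / y)"
      using y by (simp add: field_simps)
    also have "\<dots> \<le> ?L m * exp (- 2 * D / N)"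
    proof (rule mult_left_mono)
      have "1 - j / y \<le> exp (- j / y)"
        using exp_ge_add_one_self[of "- j / y"] by simp
      also have "exp (- j / y) \<le> exp (- 2 * D / N)"
        using j N by (simp add: y_def field_simps)
      finally show "1 - j / y \<le> exp (- 2 * D / N)" .
    qed simp
    finally show ?thesis by (simp add: mult_ac)
  next
    case False
    \<comment> \<open>A cut cannot have more edges than the whole graph, which has
      \<open>N / 2\<close>.\<close>
    have "large_cut_graphs n r S (m + 2) = {}"
    proof (rule equals0I)
      fix E assume "E \<in> large_cut_graphs n r S (m + 2)"
      then have E: "E \<in> regular_graphs n r" and cut: "m + 2 \<le> card (arcs S ({1..n} - S) E)"
        by (auto simp: large_cut_graphs_def)
      have "2 * (m + 2) \<le> 2 * card (arcs S ({1..n} - S) E)" using cut by simp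
      also have "\<dots> \<le> r * n" unfolding card_arcs_cut[OF E S, symmetric] by (rule le_add2)
      finally have "2 * (m + 2) \<le> r * n" .
      then have "real (2 * (m + 2)) \<le> real (r * n)" by (rule of_nat_mono)
      with False show False by (simp add: N_def)
    qed
    then show ?thesis by simp
  qed
  have iter: "?L (M0 + 2 * t) \<le> exp (- 2 * D / N) ^ t * ?L M0" for t
  proof (induction t)
    case (Suc t)
    have "?L (M0 + 2 * Suc t) \<le> exp (- 2 * D / N) * ?L (M0 + 2 * t)"
      using step[of "M0 + 2 * t"] by (simp add: algebra_simps)
    also have "\<dots> \<le> exp (- 2 * D / N) * (exp (- 2 * D / N) ^ t * ?L M0)"
      using Suc.IH by - (rule mult_left_mono; auto)
    finally show ?case by (simp add: mult_ac)
  qed simp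
  \<comment> \<open>Rounding down ensures
    \<open>M0 + 2 * t \<le> N / 4 + D + 1 \<le> M\<close>.\<close>
  define t where "t = nat \<lfloor>D / 4\<rfloor>"
  have t: "D / 4 - 1 \<le> real t" "real t \<le> D / 4"
    using D0 by (simp_all add: t_def) linarith+
  have "real (M0 + 2 * t) \<le> real M"
    using M0 t M by (simp add: N_def)
  then have "M0 + 2 * t \<le> M" by (simp only: of_nat_le_iff)
  then have "?L M \<le> ?L (M0 + 2 * t)"
    using finite_large_cut_graphs
    by (intro of_nat_mono card_mono) (auto simp: large_cut_graphs_def)
  also note iter
  also have "exp (- 2 * D / N) ^ t * ?L M0 \<le> exp (1 - D\<^sup>2 / (2 * N)) * real (card (regular_graphs n r))"
  proof (intro mult_mono)
    have "real t * (- 2 * D / N) \<le> (D / 4 - 1) * (- 2 * D / N)"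
      using t D0 N by (intro mult_right_mono_neg) (auto simp: divide_nonpos_pos)
    also have "\<dots> = 2 * D / N - D\<^sup>2 / (2 * N)"
      using N by (simp add: field_simps power2_eq_square)
    \<comment> \<open>The step lost to rounding costs at most a factor
      \<open>exp (2 * D / N)\<close>, hence at most \<open>exp 1\<close>.\<close>
    also have "\<dots> \<le> 1 - D\<^sup>2 / (2 * N)"
      using D(2) N by (simp add: N_def)
    finally show "exp (- 2 * D / N) ^ t \<le> exp (1 - D\<^sup>2 / (2 * N))"
      by (simp add: exp_of_nat_mult[symmetric])
    show "?L M0 \<le> real (card (regular_graphs n r))"
      using finite_regular_graphs
      by (intro of_nat_mono card_mono) (auto simp: large_cut_graphs_def)
  qed auto
  finally show ?thesis by (simp add: N_def)
qed

subsection \<open>Small vector chromatic number forces a large cut\<close>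

text \<open>The regular simplex: the unit basis vectors are centred at their barycentre and rescaled
  by \<open>q\<close>. It shows that the value \<open>n\<close> is always admissible, so the infimum
  defining the vector chromatic number is over a nonempty set.\<close>

lemma simplex_vectors:
  assumes n: "2 \<le> (n :: nat)"
  shows "\<exists>v :: nat \<Rightarrow> nat \<Rightarrow> real.
    (\<forall>i\<in>{1..n}. (\<Sum>l\<in>{1..n}. (v i l)\<^sup>2) = 1) \<and>
    (\<forall>i\<in>{1..n}. \<forall>j\<in>{1..n}. i \<noteq> j \<longrightarrow> (\<Sum>l\<in>{1..n}. v i l * v j l) = - 1 / (real n - 1))"
proof -
  define q where "q = sqrt (real n / (real n - 1))"
  define v :: "nat \<Rightarrow> nat \<Rightarrow> real" where "v i l = q * (of_bool (l = i) - 1 / real n)" for i l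
  have q2: "q * q = real n / (real n - 1)" using n by (simp add: q_def)
  have "(\<Sum>l\<in>{1..n}. v i l * v j l) = q * q * (of_bool (i = j) - 1 / real n)"
    if "i \<in> {1..n}" "j \<in> {1..n}" for i j
  proof -
    have "v i l * v j l = q * q * (of_bool (l = i) * of_bool (i = j) - of_bool (l = i) / n
        - of_bool (l = j) / n + 1 / n\<^sup>2)" for l
      using n by (auto simp: v_def field_simps power2_eq_square)
    then have "(\<Sum>l\<in>{1..n}. v i l * v j l)
        = q * q * ((\<Sum>l\<in>{1..n}. of_bool (l = i)) * of_bool (i = j)
          - (\<Sum>l\<in>{1..n}. of_bool (l = i)) / n - (\<Sum>l\<in>{1..n}. of_bool (l = j)) / n + n * (1 / n\<^sup>2))"
      by (simp add: sum.distrib sum_subtractf flip: sum_distrib_left sum_distrib_right sum_divide_distrib)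
    moreover have "(\<Sum>l\<in>{1..n}. of_bool (l = i')) = (1 :: real)" if "i' \<in> {1..n}" for i'
      using that by (simp add: of_bool_def sum.delta)
    ultimately show ?thesis using that n by (simp add: power2_eq_square)
  qed
  then have *: "(\<Sum>l\<in>{1..n}. v i l * v j l) = real n / (real n - 1) * (of_bool (i = j) - 1 / real n)"
    if "i \<in> {1..n}" "j \<in> {1..n}" for i j
    using that q2 by simp
  have "(\<Sum>l\<in>{1..n}. (v i l)\<^sup>2) = 1" if "i \<in> {1..n}" for i
    unfolding power2_eq_square *[OF that that] using n by (simp add: field_simps)
  moreover have "(\<Sum>l\<in>{1..n}. v i l * v j l) = - 1 / (real n - 1)"
    if "i \<in> {1..n}" "j \<in> {1..n}" "i \<noteq> j" for i j
    unfolding *[OF that(1,2)] using n that(3) by (simp add: field_simps)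
  ultimately show ?thesis by blast
qed

text \<open>Products of signs are 1 on arcs inside either side and -1 across, so with
  \<open>c\<close> cut edges they sum to \<open>r * n - 4 * c\<close>. The rounding bound
  \<open>- r * n / (e * k)\<close> on this sum becomes the lower bound on \<open>c\<close>.\<close>

lemma exists_large_cut:
  assumes E: "E \<in> regular_graphs n r" and n: "2 \<le> n"
    and k: "vector_chromatic_number n E \<le> real k"
  shows "0 < k" "\<exists>S\<subseteq>{1..n}. real r * real n / 4 + exp (- 1) * (real r * real n) / (4 * real k)
    \<le> real (card (arcs S ({1..n} - S) E))"
proof -
  let ?V = "{1..n}"
  define K where "K = {k'. k' > 1 \<and>
        (\<exists>v :: nat \<Rightarrow> nat \<Rightarrow> real.
            (\<forall>i\<in>{1..n}. (\<Sum>l\<in>{1..n}. (v i l)\<^sup>2) = 1) \<and>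
            (\<forall>i\<in>{1..n}. \<forall>j\<in>{1..n}. {i, j} \<in> E \<longrightarrow>
                (\<Sum>l\<in>{1..n}. v i l * v j l) \<le> - 1 / (k' - 1)))}"
  have "real n \<in> K"
  proof -
    obtain v :: "nat \<Rightarrow> nat \<Rightarrow> real"
      where "\<forall>i\<in>{1..n}. (\<Sum>l\<in>{1..n}. (v i l)\<^sup>2) = 1"
      and "\<forall>i\<in>{1..n}. \<forall>j\<in>{1..n}. i \<noteq> j \<longrightarrow> (\<Sum>l\<in>{1..n}. v i l * v j l) = - 1 / (real n - 1)"
      using simplex_vectors[OF n] by blast
    then show ?thesis
      using n regular_graphs_edgeD(3)[OF E] unfolding K_def by auto
  qed
  moreover have "Inf K < real k + 1"
    using k by (simp add: vector_chromatic_number_def K_def)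
  \<comment> \<open>The infimum need not be attained; a slack of 1 still leaves inner products at most \<open>-1/k\<close>.\<close>
  ultimately obtain k' where k': "k' \<in> K" "k' < real k + 1"
    using cInf_lessD[of K] by blast
  then have "1 < k'" by (simp add: K_def)
  with k' show k0: "0 < k" by linarith
  obtain v where v: "\<forall>i\<in>?V. (\<Sum>l\<in>?V. (v i l)\<^sup>2) = 1"
    and inner: "\<forall>i\<in>?V. \<forall>j\<in>?V. {i, j} \<in> E \<longrightarrow> (\<Sum>l\<in>?V. v i l * v j l) \<le> - 1 / (k' - 1)"
    using k' by (auto simp: K_def)
  have le: "- 1 / (k' - 1) \<le> - (1 / real k)"
    using k' \<open>1 < k'\<close> k0 by (simp add: field_simps)
  let ?B = "arcs ?V ?V E"
  have cardB: "card ?B = n * r"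
    using card_arcs_from[OF E, of ?V] by simp
  have irrefl: "(i, i) \<notin> ?B" for i
    using regular_graphs_edgeD(3)[OF E, of i i] by (auto simp: arcs_def)
  have "\<exists>x. (\<forall>i. \<bar>x i\<bar> \<le> 1) \<and> (\<Sum>(i, j)\<in>?B. x i * x j) \<le> - exp (- 1) * (1 / real k) * real (card ?B)"
  proof (rule exists_bounded_rounding[of ?V ?B _ v])
    fix i j assume "(i, j) \<in> ?B"
    then have ij: "i \<in> ?V" "j \<in> ?V" "{i, j} \<in> E" by (auto simp: arcs_def)
    show "(\<Sum>l\<in>?V. (v i l)\<^sup>2) = 1 \<and> (\<Sum>l\<in>?V. (v j l)\<^sup>2) = 1" using v ij by blast
    show "(\<Sum>l\<in>?V. v i l * v j l) \<le> - (1 / real k)" using inner ij le by fastforce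
  qed auto
  then obtain x where x: "\<And>i. \<bar>x i\<bar> \<le> 1"
    "(\<Sum>(i, j)\<in>?B. x i * x j) \<le> - exp (- 1) * (1 / real k) * real (card ?B)" by blast
  obtain s where s: "\<forall>i\<in>?V. s i = 1 \<or> s i = - (1 :: real)"
    "(\<Sum>(i, j)\<in>?B. s i * s j) \<le> (\<Sum>(i, j)\<in>?B. x i * x j)"
    using exists_sign_rounding[of ?B ?V x] irrefl x(1) by auto
  define S where "S = {i \<in> ?V. s i = 1}"
  let ?T = "?V - S"
  have S: "S \<subseteq> ?V" by (auto simp: S_def)
  have sS: "s i = 1" if "i \<in> S" for i using that by (simp add: S_def)
  have sT: "s i = - 1" if "i \<in> ?T" for i using that s(1) by (auto simp: S_def)
  let ?a = "arcs S S E" and ?b = "arcs ?T ?T E" and ?c = "arcs S ?T E" and ?d = "arcs ?T S E"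
  have B: "?B = (?a \<union> ?b) \<union> (?c \<union> ?d)" using S by (auto simp: arcs_def)
  have fin: "finite S" "finite ?T" using S finite_subset by blast+
  have ab: "card (?a \<union> ?b) = card ?a + card ?b"
    using fin by (intro card_Un_disjoint finite_arcs) (auto simp: arcs_def)
  have cd: "card (?c \<union> ?d) = card ?c + card ?d"
    using fin by (intro card_Un_disjoint finite_arcs) (auto simp: arcs_def)
  have "(\<Sum>(i, j)\<in>?B. s i * s j) = (\<Sum>(i, j)\<in>?a \<union> ?b. s i * s j) + (\<Sum>(i, j)\<in>?c \<union> ?d. s i * s j)"
    unfolding B using fin by (intro sum.union_disjoint finite_UnI finite_arcs) (auto simp: arcs_def)
  also have "(\<Sum>(i, j)\<in>?a \<union> ?b. s i * s j) = (\<Sum>(i, j)\<in>?a \<union> ?b. 1)"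
    by (intro sum.cong refl) (auto simp: arcs_def sS sT)
  also have "\<dots> = real (card ?a + card ?b)"
    using ab by simp
  also have "(\<Sum>(i, j)\<in>?c \<union> ?d. s i * s j) = (\<Sum>(i, j)\<in>?c \<union> ?d. - 1)"
    by (intro sum.cong refl) (auto simp: arcs_def sS sT)
  also have "\<dots> = - real (card ?c + card ?d)"
    using cd by simp
  also have "card ?d = card ?c" by (rule card_arcs_commute)
  finally have "(\<Sum>(i, j)\<in>?B. s i * s j) = real (card ?a + card ?b + 2 * card ?c) - 4 * real (card ?c)"
    by simp
  also have "card ?a + card ?b + 2 * card ?c = r * n" by (rule card_arcs_cut[OF E S])
  finally have "real (r * n) - 4 * real (card ?c) \<le> - exp (- 1) * (1 / real k) * real (card ?B)"
    using s(2) x(2) by linarith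
  then have "real r * real n / 4 + exp (- 1) * (real r * real n) / (4 * real k) \<le> real (card ?c)"
    using k0 unfolding cardB by (simp add: field_simps)
  then show "\<exists>S\<subseteq>?V. real r * real n / 4 + exp (- 1) * (real r * real n) / (4 * real k)
    \<le> real (card (arcs S (?V - S) E))" using S by blast
qed

section \<open>Union bound over all vertex sets\<close>

lemma few_graphs_with_small_vector_chromatic_number:
  assumes n: "2 \<le> n" and kr: "3600 * real k ^ 2 \<le> real r" and rn: "real r \<le> sqrt (real n) / 2"
  shows "real (card {E \<in> regular_graphs n r. vector_chromatic_number n E \<le> real k})
    \<le> exp (- real n) * real (card (regular_graphs n r))"
proof (cases "k = 0")
  case True
  have False if "E \<in> regular_graphs n r" "vector_chromatic_number n E \<le> real k" for E
    using exists_large_cut(1)[OF that(1) n that(2)] True by simp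
  then have "{E \<in> regular_graphs n r. vector_chromatic_number n E \<le> real k} = {}"
    by blast
  then show ?thesis by (simp only: card.empty) simp
next
  case False
  let ?R = "regular_graphs n r" and ?V = "{1..n}"
  let ?bad = "{E \<in> ?R. vector_chromatic_number n E \<le> real k}"
  define N where "N = real r * real n"
  define w where "w = sqrt (real r)"
  have w2: "w * w = real r" by (simp add: w_def)
  have "sqrt (3600 * real k ^ 2) \<le> w" unfolding w_def using kr by (rule real_sqrt_le_mono)
  \<comment> \<open>Here 3600 is the square of \<open>60 = 3 * 4 * 5\<close>: 3 bounds e, 4 comes
    from the excess \<open>N / (4 * e * k)\<close>, and 5 makes this excess at least
    \<open>5 * w * n\<close>, which covers \<open>D + 1\<close>.\<close>
  then have wk: "60 * real k \<le> w" by (simp add: real_sqrt_mult)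
  have k1: "1 \<le> real k" using False by simp
  have w60: "60 \<le> w" using wk k1 by linarith
  have r0: "0 < r" using w60 by (intro gr0I) (simp add: w_def)
  \<comment> \<open>Chosen so that \<open>D^2 / (2 * N) = 8 * n\<close>. The requirement
    \<open>8 * r^2 \<le> D\<close> is where the upper bound on \<open>r\<close> enters.\<close>
  define D where "D = 4 * w * real n"
  define M where "M = nat \<lceil>N / 4 + D + 1\<rceil>"
  have D0: "0 \<le> D" using w60 by (simp add: D_def)
  have M: "N / 4 + D + 1 \<le> real M" unfolding M_def by (rule real_nat_ceiling_ge)
  have "real r ^ 2 \<le> (sqrt (real n) / 2) ^ 2" using rn by (intro power_mono) auto
  then have "8 * real r ^ 2 \<le> 2 * real n" by (simp add: power_divide)
  also have "\<dots> \<le> D" unfolding D_def using w60 by - (rule mult_right_mono; auto)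
  finally have D1: "8 * real r ^ 2 \<le> D" .
  have "8 * w \<le> w * w" using w60 by - (rule mult_right_mono; auto)
  then have "8 * w * real n \<le> w * w * real n" by - (rule mult_right_mono; auto)
  then have D2: "2 * D \<le> real r * real n" by (simp add: D_def w2)
  have DN: "D\<^sup>2 / (2 * N) = 8 * real n"
    using w60 n by (simp add: D_def N_def power2_eq_square flip: w2)
  have sub: "?bad \<subseteq> (\<Union>S\<in>Pow ?V. large_cut_graphs n r S M)"
  proof
    fix E assume "E \<in> ?bad"
    then have E: "E \<in> ?R" and vcn: "vector_chromatic_number n E \<le> real k" by auto
    obtain S where S: "S \<subseteq> ?V"
      and cut: "N / 4 + exp (- 1) * N / (4 * real k) \<le> real (card (arcs S (?V - S) E))"
      using exists_large_cut(2)[OF E n vcn] by (auto simp: N_def mult.assoc)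
    have "1 / 3 \<le> exp (- 1 :: real)" using exp_le by (simp add: exp_minus field_simps)
    moreover have "5 * w * real n \<le> 1 / 3 * (N / (4 * real k))"
    proof -
      have "w * (60 * real k) \<le> w * w" using wk w60 by - (rule mult_left_mono; auto)
      then have "w * (60 * real k) * real n \<le> w * w * real n" by - (rule mult_right_mono; auto)
      then show ?thesis using k1 by (simp add: N_def field_simps flip: w2)
    qed
    moreover have "0 \<le> N / (4 * real k)" by (simp add: N_def)
    ultimately have "5 * w * real n \<le> exp (- 1) * (N / (4 * real k))"
      by (meson mult_right_mono order_trans)
    moreover have "1 \<le> w * real n" using mult_mono[of 1 w 1 "real n"] w60 n by simp
    ultimately have "N / 4 + D + 1 \<le> real (card (arcs S (?V - S) E))"
      using cut by (simp add: D_def)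
    then have "M \<le> card (arcs S (?V - S) E)" unfolding M_def by linarith
    with S E show "E \<in> (\<Union>S\<in>Pow ?V. large_cut_graphs n r S M)"
      by (auto simp: large_cut_graphs_def)
  qed
  have "real (card ?bad) \<le> real (card (\<Union>S\<in>Pow ?V. large_cut_graphs n r S M))"
    using sub finite_large_cut_graphs by (intro of_nat_mono card_mono) auto
  also have "\<dots> \<le> real (\<Sum>S\<in>Pow ?V. card (large_cut_graphs n r S M))"
    by (intro of_nat_mono card_UN_le) simp
  also have "\<dots> = (\<Sum>S\<in>Pow ?V. real (card (large_cut_graphs n r S M)))" by simp
  also have "\<dots> \<le> (\<Sum>S\<in>Pow ?V. exp (1 - 8 * real n) * real (card ?R))"
    using large_cut_tail[of _ n r D M] r0 n D1 D2 M DN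
    by (intro sum_mono) (simp add: N_def)
  also have "\<dots> = 2 ^ n * exp (1 - 8 * real n) * real (card ?R)"
    by (simp add: card_Pow)
  \<comment> \<open>The \<open>2 ^ n\<close> vertex sets cost at most \<open>exp n\<close>; the
    remaining exponent \<open>1 - 7 * n\<close> is still below \<open>- n\<close>.\<close>
  also have "\<dots> \<le> exp (real n) * exp (1 - 8 * real n) * real (card ?R)"
  proof (intro mult_right_mono)
    have "(2 :: real) ^ n \<le> exp 1 ^ n"
      using exp_ge_add_one_self[of 1] by (intro power_mono) auto
    then show "2 ^ n \<le> exp (real n)" by (simp add: exp_of_nat_mult[symmetric])
  qed auto
  also have "\<dots> \<le> exp (- real n) * real (card ?R)"
    using n by (intro mult_right_mono) (simp_all flip: exp_add)
  finally show ?thesis .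
qed

text \<open>In this model of the running time \<open>t\<close>, \<open>P\<close> bounds the
  computation of the vector chromatic number and \<open>L\<close> the exact colouring, run only when
  that number is at most \<open>k n\<close>. For large \<open>n\<close> such graphs form a
  proportion of at most \<open>exp (- n)\<close>, so the exact part costs at most 1 on average. The
  uniform distribution needs a nonempty set of graphs.\<close>

theorem theorem8:
  "\<exists>c0 :: real. c0 > 0 \<and>
    (\<forall>(k :: nat \<Rightarrow> nat) (r :: nat \<Rightarrow> nat)
       (t :: nat \<Rightarrow> nat set set \<Rightarrow> real) (P :: nat \<Rightarrow> real) (L :: nat \<Rightarrow> real) (a :: nat).
      (\<forall>n. c0 * real (k n) ^ 2 \<le> real (r n)) \<longrightarrow>
      (\<lambda>n. real (r n)) \<in> o(\<lambda>n. sqrt (real n)) \<longrightarrow>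
      P \<in> O(\<lambda>n. real n ^ a) \<longrightarrow>
      L \<in> o(\<lambda>n. exp (real n)) \<longrightarrow>
      (\<forall>n E. E \<in> regular_graphs n (r n) \<longrightarrow>
          0 \<le> t n E \<and>
          t n E \<le> P n + (if vector_chromatic_number n E \<le> real (k n) then L n else 0)) \<longrightarrow>
      (\<exists>(l :: nat) (C :: real).
         \<forall>\<^sub>F n in sequentially. regular_graphs n (r n) \<noteq> {} \<longrightarrow>
           measure_pmf.expectation (G_nr n (r n)) (t n) \<le> C * real n ^ l))"
proof (intro exI[of _ "3600 :: real"] conjI allI impI)
  fix k r :: "nat \<Rightarrow> nat" and t :: "nat \<Rightarrow> nat set set \<Rightarrow> real"
    and P L :: "nat \<Rightarrow> real" and a :: nat
  assume kr: "\<forall>n. 3600 * real (k n) ^ 2 \<le> real (r n)"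
    and ro: "(\<lambda>n. real (r n)) \<in> o(\<lambda>n. sqrt (real n))"
    and P: "P \<in> O(\<lambda>n. real n ^ a)" and L: "L \<in> o(\<lambda>n. exp (real n))"
    and t: "\<forall>n E. E \<in> regular_graphs n (r n) \<longrightarrow>
          0 \<le> t n E \<and>
          t n E \<le> P n + (if vector_chromatic_number n E \<le> real (k n) then L n else 0)"
  obtain c where c: "eventually (\<lambda>n. norm (P n) \<le> c * norm (real n ^ a)) sequentially"
    using P by (elim landau_o.bigE)
  have L': "eventually (\<lambda>n. norm (L n) \<le> 1 * norm (exp (real n))) sequentially"
    using landau_o.smallD[OF L, of 1] by simp
  have ro': "eventually (\<lambda>n. norm (real (r n)) \<le> 1 / 2 * norm (sqrt (real n))) sequentially"
    using landau_o.smallD[OF ro, of "1 / 2"] by simp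
  show "\<exists>(l :: nat) (C :: real). \<forall>\<^sub>F n in sequentially. regular_graphs n (r n) \<noteq> {} \<longrightarrow>
      measure_pmf.expectation (G_nr n (r n)) (t n) \<le> C * real n ^ l"
  \<comment> \<open>The exponent comes from \<open>P\<close>; the added 1 is the expected cost of
    the exact part, absorbed by \<open>1 \<le> n ^ a\<close>.\<close>
  proof (intro exI[of _ a] exI[of _ "c + 1"])
    show "\<forall>\<^sub>F n in sequentially. regular_graphs n (r n) \<noteq> {} \<longrightarrow>
      measure_pmf.expectation (G_nr n (r n)) (t n) \<le> (c + 1) * real n ^ a"
      using c L' ro' eventually_ge_at_top[of 2]
    proof eventually_elim
      case (elim n)
      show ?case
      proof
        let ?R = "regular_graphs n (r n)"
        let ?bad = "{E \<in> ?R. vector_chromatic_number n E \<le> real (k n)}"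
        assume ne: "?R \<noteq> {}"
        note fin = finite_regular_graphs[of n "r n"]
        have cpos: "0 < real (card ?R)" using ne fin by (simp add: card_gt_0_iff)
        \<comment> \<open>For large \<open>n\<close> the cost \<open>L n\<close> is at most
          \<open>exp n\<close>, which the rarity of bad graphs cancels exactly.\<close>
        have "(\<Sum>E\<in>?R. t n E) \<le> (\<Sum>E\<in>?R. P n + (if vector_chromatic_number n E \<le> real (k n) then exp (real n) else 0))"
        proof (rule sum_mono)
          fix E assume "E \<in> ?R"
          with t have "t n E \<le> P n + (if vector_chromatic_number n E \<le> real (k n) then L n else 0)"
            by blast
          with elim(2) show "t n E \<le> P n + (if vector_chromatic_number n E \<le> real (k n) then exp (real n) else 0)"
            by (auto split: if_splits)
        qed
        also have "\<dots> = real (card ?R) * P n + real (card ?bad) * exp (real n)"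
          using fin by (simp add: sum.distrib sum.If_cases Int_def)
        also have "real (card ?bad) * exp (real n) \<le> exp (- real n) * real (card ?R) * exp (real n)"
        proof (intro mult_right_mono few_graphs_with_small_vector_chromatic_number)
          show "real (r n) \<le> sqrt (real n) / 2" using elim(3) by simp
        qed (use elim(4) kr in auto)
        also have "\<dots> = real (card ?R)" by (simp add: exp_minus)
        finally have "(\<Sum>E\<in>?R. t n E) \<le> (P n + 1) * real (card ?R)"
          by (simp add: algebra_simps)
        then have "(\<Sum>E\<in>?R. t n E) / real (card ?R) \<le> P n + 1"
          using cpos by (simp add: pos_divide_le_eq)
        also have "\<dots> \<le> (c + 1) * real n ^ a"
        proof -
          have "1 \<le> real n ^ a" using elim(4) by simp
          with elim(1) show ?thesis by (simp add: distrib_right abs_le_iff)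
        qed
        finally show "measure_pmf.expectation (G_nr n (r n)) (t n) \<le> (c + 1) * real n ^ a"
          using ne fin by (simp add: G_nr_def integral_pmf_of_set)
      qed
    qed
  qed
qed simp

end
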